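(* Let $U \subseteq \mathbb{R}^K$ be open and convex, and let $Q : U \to \mathbb{R}^K$ be differentiable and satisfy the law of demand. Let $H \subseteq U$ be an open set and let $Q_H : H \to \mathbb{R}^K$ denote the restriction of $Q$ to $H$. If the Jacobian matrix of $Q_H$ is invertible at every point of $H$, then $Q_H$ is injective.
   Context: A mapping $Q : U \subseteq \mathbb{R}^K \to \mathbb{R}^K$ satisfies the law of demand if for all $u, \tilde{u} \in U$, $(Q(u) - Q(\tilde{u})) \cdot (u - \tilde{u}) \geq 0$. Differentiable means differentiable at every point (the derivative is not assumed continuous). *)

theory Defs
  imports "HOL-Analysis.Analysis"
begin

definition law_of_demand :: "(real ^ 'k) set \<Rightarrow> (real ^ 'k \<Rightarrow> real ^ 'k) \<Rightarrow> bool" where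
  "law_of_demand U Q \<longleftrightarrow> (\<forall>u\<in>U. \<forall>u'\<in>U. (Q u - Q u') \<bullet> (u - u') \<ge> 0)"

end

(* A continuous monotone map on an open convex set has convex level sets (Minty's argument), so two
   points with the same value would make the map constant on the segment joining them. Its derivative
   at an endpoint then vanishes in the direction of the segment and is not invertible. *)
theory Submission
  imports Defs
begin

text \<open>For continuous monotone \<open>Q\<close> on open \<open>U\<close>, a point
  \<open>c\<close> of \<open>U\<close> solves \<open>Q c = y\<close> exactly when
  \<open>(Q u - y) \<bullet> (u - c) \<ge> 0\<close> for all \<open>u\<close> in \<open>U\<close>.
  Each of these inequalities is affine in \<open>c\<close>, so the solutions form a convex
  set.\<close>

lemma law_of_demand_convex_level:
  fixes Q :: "real ^ 'k \<Rightarrow> real ^ 'k"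
  assumes U: "open U" "convex U" and cont: "continuous_on U Q" and law: "law_of_demand U Q"
  shows "convex {u \<in> U. Q u = y}"
proof (rule convexI)
  fix a b and p q :: real
  assume a: "a \<in> {u \<in> U. Q u = y}" and b: "b \<in> {u \<in> U. Q u = y}"
    and pq: "0 \<le> p" "0 \<le> q" "p + q = 1"
  define c where "c = p *\<^sub>R a + q *\<^sub>R b"
  have c: "c \<in> U"
    using convexD[OF U(2), of a b p q] a b pq by (simp add: c_def)
  \<comment> \<open>At \<open>a\<close> and \<open>b\<close> in place of \<open>c\<close> this is
    the law of demand, since both have value \<open>y\<close>; the weights \<open>p\<close> and
    \<open>q\<close> then combine the two inequalities.\<close>
  have ge: "(Q u - y) \<bullet> (u - c) \<ge> 0" if u: "u \<in> U" for u
  proof -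
    have "u = p *\<^sub>R u + q *\<^sub>R u"
      using pq(3) by (metis scaleR_add_left scaleR_one)
    then have "u - c = p *\<^sub>R (u - a) + q *\<^sub>R (u - b)"
      by (simp add: c_def scaleR_diff_right)
    moreover have "(Q u - y) \<bullet> (u - a) \<ge> 0" "(Q u - y) \<bullet> (u - b) \<ge> 0"
      using law a b u unfolding law_of_demand_def by (metis (mono_tags) mem_Collect_eq)+
    ultimately show ?thesis
      using pq by (simp add: inner_add_right)
  qed
  \<comment> \<open>Testing \<open>ge\<close> along this direction is decisive: in the limit its
    left side becomes \<open>- (h \<bullet> h)\<close>, which forces \<open>h = 0\<close>.\<close>
  define h where "h = y - Q c"
  have line: "((\<lambda>s. c + s *\<^sub>R h) \<longlongrightarrow> c) (at_right 0)"
    by (auto intro!: tendsto_eq_intros)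
  have "isCont Q c"
    using cont U(1) c by (simp add: continuous_on_eq_continuous_at)
  then have "((\<lambda>s. (Q (c + s *\<^sub>R h) - y) \<bullet> h) \<longlongrightarrow> (Q c - y) \<bullet> h) (at_right 0)"
    by (intro tendsto_intros isCont_tendsto_compose[OF _ line])
  \<comment> \<open>For small \<open>s > 0\<close> the point \<open>c + s *\<^sub>R h\<close> is
    still in the open set \<open>U\<close>, and the factor \<open>s\<close> cancels from
    \<open>ge\<close>.\<close>
  moreover have "\<forall>\<^sub>F s in at_right 0. 0 \<le> (Q (c + s *\<^sub>R h) - y) \<bullet> h"
    using topological_tendstoD[OF line U(1) c] eventually_at_right_less
  proof eventually_elim
    case (elim s)
    then show ?case
      using ge[of "c + s *\<^sub>R h"] by (simp add: zero_le_mult_iff)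
  qed
  ultimately have "(Q c - y) \<bullet> h \<ge> 0"
    by (rule tendsto_lowerbound) simp
  moreover have "(Q c - y) \<bullet> h = - (h \<bullet> h)"
    by (simp add: h_def algebra_simps)
  ultimately have "h = 0"
    by (metis inner_ge_zero inner_eq_zero_iff neg_0_le_iff_le order_antisym)
  then show "p *\<^sub>R a + q *\<^sub>R b \<in> {u \<in> U. Q u = y}"
    using c by (simp add: h_def c_def)
qed

text \<open>By the chain rule \<open>D (b - a)\<close> is the one-sided derivative at 0 of
  \<open>f\<close> along the segment, and that function of \<open>t\<close> is constant on
  \<open>{0..1}\<close>.\<close>

lemma has_derivative_eq_0_if_const_on_segment:
  fixes f :: "'a::real_normed_vector \<Rightarrow> 'b::real_normed_vector"
  assumes f: "(f has_derivative D) (at a)"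
    and const: "\<And>x. x \<in> closed_segment a b \<Longrightarrow> f x = f a"
  shows "D (b - a) = 0"
proof -
  let ?g = "\<lambda>t::real. a + t *\<^sub>R (b - a)"
  have "(?g has_vector_derivative (b - a)) (at 0 within {0..1})"
    by (auto intro!: derivative_eq_intros)
  moreover have "(f has_derivative D) (at (?g 0) within ?g ` {0..1})"
    using f by (simp add: has_derivative_at_withinI)
  ultimately have "((f \<circ> ?g) has_vector_derivative D (b - a)) (at 0 within {0..1})"
    by (rule vector_derivative_diff_chain_within)
  moreover have "((f \<circ> ?g) has_vector_derivative 0) (at 0 within {0..1})"
  proof (rule has_vector_derivative_transform)
    show "((\<lambda>t. f a) has_vector_derivative 0) (at 0 within {0..1})"
      by (rule has_vector_derivative_const)
    show "(f \<circ> ?g) t = f a" if "t \<in> {0..1}" for t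
    proof -
      have "?g t \<in> closed_segment a b"
        unfolding in_segment using that by (intro exI[of _ t]) (simp add: algebra_simps)
      then show ?thesis unfolding o_def by (rule const)
    qed
  qed simp
  ultimately show ?thesis
    by (intro vector_derivative_unique_within) (simp_all add: trivial_limit_within)
qed

theorem proposition2:
  fixes U H :: "(real ^ 'k) set"
    and Q :: "real ^ 'k \<Rightarrow> real ^ 'k"
  assumes "open U" and "convex U"
    and "Q differentiable_on U"
    and "law_of_demand U Q"
    and "open H" and "H \<subseteq> U"
    and "\<And>x. x \<in> H \<Longrightarrow> invertible (jacobian (restrict Q H) (at x within H))"
  shows "inj_on (restrict Q H) H"
proof (rule inj_onI)
  fix a b
  assume a: "a \<in> H" and b: "b \<in> H" and "restrict Q H a = restrict Q H b"
  then have ab: "Q b = Q a" by simp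
  have "convex {u \<in> U. Q u = Q a}"
    using assms by (intro law_of_demand_convex_level differentiable_imp_continuous_on)
  then have seg: "closed_segment a b \<subseteq> {u \<in> U. Q u = Q a}"
    using a b ab assms(6) by (intro closed_segment_subset) auto
  \<comment> \<open>The segment lies in \<open>U\<close> but may leave \<open>H\<close>, where
    \<open>restrict Q H\<close> is \<open>undefined\<close>. Hence the derivative of the restriction
    is carried over to \<open>Q\<close> itself, first within \<open>H\<close> and then, as
    \<open>H\<close> is open, at \<open>a\<close> without restriction.\<close>
  define D where "D = frechet_derivative (restrict Q H) (at a within H)"
  have "Q differentiable (at a within H)"
    using assms(3,6) a by (meson differentiable_on_def differentiable_on_subset)
  then have "restrict Q H differentiable (at a within H)"
    by (rule differentiable_transform_within[OF _ zero_less_one a]) simp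
  then have "(restrict Q H has_derivative D) (at a within H)"
    by (simp add: D_def flip: frechet_derivative_works)
  then have "(Q has_derivative D) (at a within H)"
    by (rule has_derivative_transform[OF a, rotated]) simp
  then have D: "(Q has_derivative D) (at a)"
    by (simp add: at_within_open[OF a assms(5)])
  have "D (b - a) = 0"
    using seg by (intro has_derivative_eq_0_if_const_on_segment[OF D]) auto
  then have "matrix D *v (b - a) = 0"
    using has_derivative_linear[OF D] by (simp add: matrix_works)
  moreover have "invertible (matrix D)"
    using assms(7)[OF a] by (simp add: jacobian_def D_def)
  ultimately have "b - a = 0"
    using matrix_left_invertible_ker[of "matrix D"] by (auto simp: invertible_def)
  then show "a = b" by simp
qed

end
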